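(* Let $r\geq 1$ and $n\geq 2r$ be integers, and let $\Omega=\{1,\ldots,n\}$. There exist a subgroup $\Gamma$ of the symmetric group $\mathfrak{S}_n$ of order $2^{r-1}$ and a subset of $\Omega$ of size $r$ that is not $\Gamma$-reconstructible.
   Context: Let $\Gamma$ be a group of permutations of $\Omega$. Two subsets $A,B$ of $\Omega$ are $\Gamma$-isomorphic if $\sigma\cdot A=B$ for some $\sigma\in\Gamma$. A subset $B$ is a $\Gamma$-reconstruction of a subset $A$ if there is a bijection $\phi:A\to B$ such that for every $e\in A$ the subsets $A\setminus\{e\}$ and $B\setminus\{\phi(e)\}$ are $\Gamma$-isomorphic. A subset $A$ is $\Gamma$-reconstructible if every $\Gamma$-reconstruction of $A$ is $\Gamma$-isomorphic to $A$. *)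

theory Defs
  imports "HOL-Algebra.Sym_Groups"
begin

definition perm_isomorphic :: "('a \<Rightarrow> 'a) set \<Rightarrow> 'a set \<Rightarrow> 'a set \<Rightarrow> bool"
  where "perm_isomorphic \<Gamma> A B \<longleftrightarrow> (\<exists>\<sigma>\<in>\<Gamma>. \<sigma> ` A = B)"

definition perm_reconstruction :: "('a \<Rightarrow> 'a) set \<Rightarrow> 'a set \<Rightarrow> 'a set \<Rightarrow> bool"
  where "perm_reconstruction \<Gamma> A B \<longleftrightarrow>
    (\<exists>\<phi>. bij_betw \<phi> A B \<and> (\<forall>e\<in>A. perm_isomorphic \<Gamma> (A - {e}) (B - {\<phi> e})))"

(* \<Omega> is explicit because the competing sets B range over subsets of \<Omega>, not over
   arbitrary sets of the ambient type; A is meant to be a subset of \<Omega> as well. *)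
definition perm_reconstructible :: "'a set \<Rightarrow> ('a \<Rightarrow> 'a) set \<Rightarrow> 'a set \<Rightarrow> bool"
  where "perm_reconstructible \<Omega> \<Gamma> A \<longleftrightarrow>
    (\<forall>B\<subseteq>\<Omega>. perm_reconstruction \<Gamma> A B \<longrightarrow> perm_isomorphic \<Gamma> B A)"

end

theory Submission
  imports Defs
begin

text \<open>
  Split \<open>2 * r\<close> of the points into the pairs \<open>{i, i + r}\<close> for \<open>1 \<le> i \<le> r\<close>. Swapping the two points
  in each of a chosen set of pairs gives a copy of \<open>(\<int>/2)\<^sup>r\<close> inside the symmetric group, and \<open>\<Gamma>\<close> is
  its index-two subgroup in which an even number of pairs is swapped. Let \<open>A = {1..r}\<close>, and let \<open>B\<close>
  be \<open>A\<close> with \<open>1\<close> replaced by its partner \<open>1 + r\<close>.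

  The only swap taking \<open>B\<close> to \<open>A\<close> swaps exactly one pair, which is odd, so \<open>A\<close> and \<open>B\<close> are not
  isomorphic under \<open>\<Gamma>\<close>. But once a point \<open>e\<close> is deleted from \<open>A\<close>, its pair contains no point of the
  set any more, so swapping that pair costs nothing and repairs the parity: the swap of the pairs of
  \<open>1\<close> and \<open>e\<close> (or of no pair, if \<open>e = 1\<close>) takes \<open>A - {e}\<close> to \<open>B\<close> minus the point
  of \<open>B\<close> in the pair of \<open>e\<close>. Hence \<open>B\<close> is a reconstruction of \<open>A\<close>.
\<close>

definition pair_swap :: "nat \<Rightarrow> nat set \<Rightarrow> nat \<Rightarrow> nat"
  where "pair_swap r S x =
    (if x \<in> S then x + r else if r \<le> x \<and> x - r \<in> S then x - r else x)"

definition even_swaps :: "nat \<Rightarrow> (nat \<Rightarrow> nat) set"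
  where "even_swaps r = pair_swap r ` {S. S \<subseteq> {1..r} \<and> even (card S)}"

lemma pair_swap_simps:
  assumes "S \<subseteq> {1..r}"
  shows "x \<le> r \<Longrightarrow> pair_swap r S x = (if x \<in> S then x + r else x)"
    and "1 \<le> y \<Longrightarrow> pair_swap r S (y + r) = (if y \<in> S then y else y + r)"
  using assms by (auto simp: pair_swap_def)

lemma pair_swap_comp:
  assumes S: "S \<subseteq> {1..r}" and T: "T \<subseteq> {1..r}"
  shows "pair_swap r S \<circ> pair_swap r T = pair_swap r (sym_diff S T)"
proof
  fix x
  have ST: "sym_diff S T \<subseteq> {1..r}" using S T by auto
  note simps = pair_swap_simps[OF S] pair_swap_simps[OF T] pair_swap_simps[OF ST]
  show "(pair_swap r S \<circ> pair_swap r T) x = pair_swap r (sym_diff S T) x"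
  proof (cases "x \<le> r")
    case True
    moreover have "1 \<le> x" if "x \<in> T" using that T by auto
    ultimately show ?thesis by (cases "x \<in> T") (simp_all add: simps)
  next
    case False
    define y where "y = x - r"
    with False have y: "1 \<le> y" "x = y + r" by auto
    moreover have "y \<le> r" if "y \<in> T" using that T by auto
    ultimately show ?thesis by (cases "y \<in> T") (simp_all add: simps)
  qed
qed

lemma pair_swap_empty: "pair_swap r {} = id"
  by (auto simp: pair_swap_def)

lemma pair_swap_involution:
  assumes "S \<subseteq> {1..r}"
  shows "pair_swap r S \<circ> pair_swap r S = id"
  using pair_swap_comp[OF assms assms] by (simp add: pair_swap_empty)

lemma pair_swap_permutes:
  assumes "S \<subseteq> {1..r}" "2 * r \<le> n"
  shows "pair_swap r S permutes {1..n}"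
proof (rule bij_imp_permutes)
  show "pair_swap r S x = x" if "x \<notin> {1..n}" for x
    using that assms by (force simp: pair_swap_def)
  have inv: "pair_swap r S (pair_swap r S x) = x" for x
    using pair_swap_involution[OF assms(1)] by (metis comp_apply id_apply)
  have "pair_swap r S x \<in> {1..n}" if "x \<in> {1..n}" for x
    using that assms by (force simp: pair_swap_def)
  then show "bij_betw (pair_swap r S) {1..n} {1..n}"
    using inv by (intro bij_betw_byWitness[where f' = "pair_swap r S"]) auto
qed

lemma pair_swap_inj: "inj_on (pair_swap r) {S. S \<subseteq> {1..r}}"
proof (rule inj_onI)
  \<comment> \<open>The swapped pairs can be read off from the permutation.\<close>
  have "S = {x \<in> {1..r}. pair_swap r S x = x + r}" if "S \<subseteq> {1..r}" for S
    using that by (auto simp: pair_swap_def split: if_splits)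
  then show "S = T" if "S \<in> {S. S \<subseteq> {1..r}}" "T \<in> {S. S \<subseteq> {1..r}}"
    "pair_swap r S = pair_swap r T" for S T
    using that by (metis mem_Collect_eq)
qed

lemma even_card_sym_diff:
  assumes "finite S" "finite T"
  shows "even (card (sym_diff S T)) \<longleftrightarrow> (even (card S) \<longleftrightarrow> even (card T))"
proof -
  have "card (sym_diff S T) = card (S - T) + card (T - S)"
    using assms by (intro card_Un_disjoint) auto
  moreover have "card S = card (S - T) + card (S \<inter> T)" "card T = card (T - S) + card (S \<inter> T)"
    using assms by (metis card_Diff_subset_Int card_mono finite_Int inf.cobounded1
        le_add_diff_inverse2 Int_commute)+
  ultimately show ?thesis by auto
qed

lemma card_even_subsets:
  assumes "finite S" "S \<noteq> {}"
  shows "card {T. T \<subseteq> S \<and> even (card T)} = 2 ^ (card S - 1)"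
proof -
  have "{T. T \<subseteq> S \<and> even (card T)} \<union> {T. T \<subseteq> S \<and> odd (card T)} = Pow S"
    by auto
  then have "2 ^ card S = card ({T. T \<subseteq> S \<and> even (card T)} \<union> {T. T \<subseteq> S \<and> odd (card T)})"
    using assms(1) by (simp add: card_Pow)
  also have "\<dots> = card {T. T \<subseteq> S \<and> even (card T)} + card {T. T \<subseteq> S \<and> odd (card T)}"
    using assms(1) by (intro card_Un_disjoint) auto
  also have "\<dots> = 2 * card {T. T \<subseteq> S \<and> even (card T)}"
    using card_subsupersets_even_odd[of S "{}"] assms by (simp add: psubset_eq)
  finally show ?thesis
    using assms by (cases "card S") auto
qed

lemma card_even_swaps:
  assumes "r \<ge> 1"
  shows "card (even_swaps r) = 2 ^ (r - 1)"
proof -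
  have "card (even_swaps r) = card {S. S \<subseteq> {1..r} \<and> even (card S)}"
    unfolding even_swaps_def by (rule card_image[OF inj_on_subset[OF pair_swap_inj]]) auto
  then show ?thesis using card_even_subsets[of "{1..r}"] assms by simp
qed

lemma subgroup_even_swaps:
  assumes "2 * r \<le> n"
  shows "subgroup (even_swaps r) (sym_group n)"
proof
  show sub: "even_swaps r \<subseteq> carrier (sym_group n)"
    using pair_swap_permutes[OF _ assms] by (auto simp: even_swaps_def sym_group_carrier)
  show "x \<otimes>\<^bsub>sym_group n\<^esub> y \<in> even_swaps r" if "x \<in> even_swaps r" "y \<in> even_swaps r" for x y
  proof -
    obtain S T where ST: "S \<subseteq> {1..r}" "even (card S)" "T \<subseteq> {1..r}" "even (card T)"
      "x = pair_swap r S" "y = pair_swap r T"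
      using \<open>x \<in> even_swaps r\<close> \<open>y \<in> even_swaps r\<close> unfolding even_swaps_def by blast
    have "finite S" "finite T"
      using ST(1,3) by (auto intro: finite_subset)
    then have "even (card (sym_diff S T))"
      using ST(2,4) by (simp only: even_card_sym_diff)
    moreover have "sym_diff S T \<subseteq> {1..r}" using ST(1,3) by blast
    ultimately have "pair_swap r (sym_diff S T) \<in> even_swaps r"
      unfolding even_swaps_def by blast
    then show ?thesis
      by (simp only: ST(5,6) sym_group_mult pair_swap_comp[OF ST(1,3)])
  qed
  show "\<one>\<^bsub>sym_group n\<^esub> \<in> even_swaps r"
    by (auto simp: even_swaps_def sym_group_one pair_swap_empty[symmetric, of r])
  show "inv\<^bsub>sym_group n\<^esub> x \<in> even_swaps r" if x: "x \<in> even_swaps r" for x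
  proof -
    have "x \<circ> x = id"
      using x pair_swap_involution by (auto simp: even_swaps_def)
    then have "inv\<^bsub>sym_group n\<^esub> x = x"
      using x sub by (intro group.inv_equality[OF sym_group_is_group])
        (auto simp: sym_group_mult sym_group_one)
    then show ?thesis using x by simp
  qed
qed

text \<open>
  Deleting \<open>e\<close> empties its pair, so swapping that pair as well makes the number of swaps even.
\<close>
lemma reconstruction_swap_one:
  assumes "r \<ge> 1"
  shows "perm_reconstruction (even_swaps r) {1..r} (pair_swap r {1} ` {1..r})"
proof -
  let ?\<phi> = "pair_swap r {1}"
  have inj: "inj ?\<phi>"
    using pair_swap_permutes[of "{1}" r "2 * r"] assms by (auto intro: permutes_inj)
  have "perm_isomorphic (even_swaps r) ({1..r} - {e}) (?\<phi> ` {1..r} - {?\<phi> e})"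
    if e: "e \<in> {1..r}" for e
  proof -
    \<comment> \<open>This is \<open>{1, e}\<close>, or \<open>{}\<close> if \<open>e = 1\<close>.\<close>
    let ?S = "sym_diff {1} {e}"
    have "even (card ?S)" "?S \<subseteq> {1..r}"
      using e assms by (auto simp: even_card_sym_diff)
    then have "pair_swap r ?S \<in> even_swaps r"
      unfolding even_swaps_def by blast
    moreover have "pair_swap r ?S ` ({1..r} - {e}) = ?\<phi> ` ({1..r} - {e})"
      using e by (intro image_cong) (auto simp: pair_swap_def)
    moreover have "?\<phi> ` ({1..r} - {e}) = ?\<phi> ` {1..r} - {?\<phi> e}"
      using image_set_diff[OF inj, of "{1..r}" "{e}"] by simp
    ultimately show ?thesis
      unfolding perm_isomorphic_def by metis
  qed
  moreover have "bij_betw ?\<phi> {1..r} (?\<phi> ` {1..r})"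
    using inj by (intro inj_on_imp_bij_betw inj_on_subset[OF inj]) auto
  ultimately show ?thesis
    unfolding perm_reconstruction_def by blast
qed

text \<open>
  Each swapped pair moves its lower point out of \<open>{1..r}\<close>.
\<close>
lemma pair_swap_stabilizer:
  assumes "S \<subseteq> {1..r}" "pair_swap r S ` {1..r} = {1..r}"
  shows "S = {}"
proof (rule ccontr)
  assume "S \<noteq> {}"
  then obtain i where i: "i \<in> S" by auto
  then have "pair_swap r S i \<in> {1..r}" using assms by blast
  with i assms(1) show False by (auto simp: pair_swap_def)
qed

lemma not_isomorphic_swap_one:
  assumes "r \<ge> 1"
  shows "\<not> perm_isomorphic (even_swaps r) (pair_swap r {1} ` {1..r}) {1..r}"
proof
  assume "perm_isomorphic (even_swaps r) (pair_swap r {1} ` {1..r}) {1..r}"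
  then obtain S where S: "S \<subseteq> {1..r}" "even (card S)"
    "pair_swap r S ` pair_swap r {1} ` {1..r} = {1..r}"
    by (auto simp: perm_isomorphic_def even_swaps_def)
  have one: "{1} \<subseteq> {1..r}" using assms by auto
  have "pair_swap r (sym_diff S {1}) ` {1..r} = {1..r}"
    using S(3) pair_swap_comp[OF S(1) one] by (simp only: image_comp)
  moreover have "sym_diff S {1} \<subseteq> {1..r}" using S(1) one by auto
  ultimately have "sym_diff S {1} = {}" by (rule pair_swap_stabilizer[rotated])
  then have "S = {1}" by auto
  with S(2) show False by simp
qed

theorem mainTheorem6:
  fixes r n :: nat
  assumes "r \<ge> 1" and "n \<ge> 2 * r"
  shows "\<exists>\<Gamma> A. subgroup \<Gamma> (sym_group n) \<and> card \<Gamma> = 2 ^ (r - 1) \<and>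
           A \<subseteq> {1..n} \<and> card A = r \<and> \<not> perm_reconstructible {1..n} \<Gamma> A"
proof (intro exI conjI)
  show "subgroup (even_swaps r) (sym_group n)" by (rule subgroup_even_swaps[OF assms(2)])
  show "card (even_swaps r) = 2 ^ (r - 1)" by (rule card_even_swaps[OF assms(1)])
  show A: "{1..r} \<subseteq> {1..n}" using assms by auto
  show "card {1..r} = r" by simp
  have "pair_swap r {1} permutes {1..n}" using assms by (intro pair_swap_permutes) auto
  then have "pair_swap r {1} ` {1..r} \<subseteq> {1..n}"
    using A permutes_image by blast
  then show "\<not> perm_reconstructible {1..n} (even_swaps r) {1..r}"
    using reconstruction_swap_one[OF assms(1)] not_isomorphic_swap_one[OF assms(1)]
    unfolding perm_reconstructible_def by blast
qed

end
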